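(* The following assertion (Lin's conjecture for three factors) is false: "for every $n\ge 1$, all positive semidefinite $A_1,A_2,A_3\in M_n$ and all real $p_1,p_2,p_3>0$ with $\frac1{p_1}+\frac1{p_2}+\frac1{p_3}=1$, there exists a unitary matrix $U\in M_n$ such that $U|A_1A_2A_3|U^*\preceq \frac1{p_1}A_1^{p_1}+\frac1{p_2}A_2^{p_2}+\frac1{p_3}A_3^{p_3}$ (equivalently, $\lambda_j(|A_1A_2A_3|)\le\lambda_j\left(\frac1{p_1}A_1^{p_1}+\frac1{p_2}A_2^{p_2}+\frac1{p_3}A_3^{p_3}\right)$ for all $j=1,\ldots,n$)." More precisely, there are real positive semidefinite matrices $A_1,A_2,A_3\in M_3$ such that, for $p_1=3/2$ and $p_2=p_3=6$ (so that $\frac1{p_1}+\frac1{p_2}+\frac1{p_3}=1$), \[ \lambda_2(|A_1A_2A_3|)>\lambda_2\left(\frac23A_1^{3/2}+\frac16A_2^6+\frac16A_3^6\right). \]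
   Context: $M_n$ denotes the set of $n\times n$ complex matrices; a real matrix in $M_n$ is one with all entries real. For $X\in M_n$, $|X|=(X^*X)^{1/2}$ is the positive semidefinite square root of $X^*X$. For Hermitian $X,Y$, $X\preceq Y$ means that $Y-X$ is positive semidefinite. For a Hermitian matrix $H\in M_n$, its eigenvalues (with multiplicity) are arranged as $\lambda_1(H)\ge\lambda_2(H)\ge\cdots\ge\lambda_n(H)$; so $\lambda_2$ is the second largest eigenvalue. For positive semidefinite $A$ and real $p>0$, $A^p$ is defined by the spectral functional calculus (with $0^p=0$). "Positive semidefinite" includes Hermitian (symmetric, in the real case). *)

theory Defs
  imports Complex_Main "Jordan_Normal_Form.Char_Poly" "Jordan_Normal_Form.Schur_Decomposition"
begin

definition real_mat :: "complex mat \<Rightarrow> bool" where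
  "real_mat A \<longleftrightarrow> (\<forall>i < dim_row A. \<forall>j < dim_col A. A $$ (i, j) \<in> \<real>)"

definition hermitian_mat :: "nat \<Rightarrow> complex mat \<Rightarrow> bool" where
  "hermitian_mat n A \<longleftrightarrow> A \<in> carrier_mat n n \<and> mat_adjoint A = A"

definition unitary_mat :: "nat \<Rightarrow> complex mat \<Rightarrow> bool" where
  "unitary_mat n U \<longleftrightarrow> U \<in> carrier_mat n n \<and>
     mat_adjoint U * U = 1\<^sub>m n \<and> U * mat_adjoint U = 1\<^sub>m n"

text \<open>For Hermitian matrices the quadratic form is real-valued, so taking the real part
  loses nothing.\<close>

definition psd_mat :: "nat \<Rightarrow> complex mat \<Rightarrow> bool" where
  "psd_mat n A \<longleftrightarrow> hermitian_mat n A \<and>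
     (\<forall>v \<in> carrier_vec n. 0 \<le> Re ((A *\<^sub>v v) \<bullet>c v))"

text \<open>The Loewner order; meaningful for Hermitian \<open>X\<close> and \<open>Y\<close> of size \<open>n\<close>.\<close>

definition loewner_le :: "nat \<Rightarrow> complex mat \<Rightarrow> complex mat \<Rightarrow> bool" where
  "loewner_le n X Y \<longleftrightarrow> psd_mat n (Y - X)"

definition mat_abs :: "complex mat \<Rightarrow> complex mat" where
  "mat_abs X = (THE P. psd_mat (dim_col X) P \<and> P * P = mat_adjoint X * X)"

text \<open>Spectral functional calculus for a Hermitian matrix \<open>A\<close>: the matrix \<open>B\<close> below does not
  depend on the diagonalisation \<open>U\<close>, \<open>d\<close> of \<open>A\<close>.\<close>

definition mat_fun :: "(real \<Rightarrow> real) \<Rightarrow> complex mat \<Rightarrow> complex mat" where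
  "mat_fun f A = (THE B. \<exists>U d. unitary_mat (dim_row A) U \<and>
     A = U * mat_diag (dim_row A) (\<lambda>i. complex_of_real (d i)) * mat_adjoint U \<and>
     B = U * mat_diag (dim_row A) (\<lambda>i. complex_of_real (f (d i))) * mat_adjoint U)"

text \<open>Note that \<open>0 powr p = 0\<close>, which is the required convention.\<close>

definition mat_powr :: "complex mat \<Rightarrow> real \<Rightarrow> complex mat" where
  "mat_powr A p = mat_fun (\<lambda>x. x powr p) A"

text \<open>\<open>eig j H\<close> is the \<open>j\<close>-th largest eigenvalue of the Hermitian matrix \<open>H\<close>, counted with
  multiplicity and starting from \<open>j = 1\<close>.  The eigenvalues are the roots of the characteristic
  polynomial; they are real, so \<open>Re\<close> is only a change of type.\<close>

definition eigs :: "complex mat \<Rightarrow> real list" where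
  "eigs H = rev (sorted_list_of_multiset (image_mset Re (proots (char_poly H))))"

definition eig :: "nat \<Rightarrow> complex mat \<Rightarrow> real" where
  "eig j H = eigs H ! (j - 1)"

definition weighted_powers3 ::
  "complex mat \<Rightarrow> complex mat \<Rightarrow> complex mat \<Rightarrow> real \<Rightarrow> real \<Rightarrow> real \<Rightarrow> complex mat" where
  "weighted_powers3 A1 A2 A3 p1 p2 p3 =
     complex_of_real (1 / p1) \<cdot>\<^sub>m mat_powr A1 p1 +
     complex_of_real (1 / p2) \<cdot>\<^sub>m mat_powr A2 p2 +
     complex_of_real (1 / p3) \<cdot>\<^sub>m mat_powr A3 p3"

definition lin_hyp ::
  "nat \<Rightarrow> complex mat \<Rightarrow> complex mat \<Rightarrow> complex mat \<Rightarrow> real \<Rightarrow> real \<Rightarrow> real \<Rightarrow> bool" where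
  "lin_hyp n A1 A2 A3 p1 p2 p3 \<longleftrightarrow>
     psd_mat n A1 \<and> psd_mat n A2 \<and> psd_mat n A3 \<and>
     p1 > 0 \<and> p2 > 0 \<and> p3 > 0 \<and> 1 / p1 + 1 / p2 + 1 / p3 = 1"

definition lin_unitary ::
  "nat \<Rightarrow> complex mat \<Rightarrow> complex mat \<Rightarrow> complex mat \<Rightarrow> real \<Rightarrow> real \<Rightarrow> real \<Rightarrow> bool" where
  "lin_unitary n A1 A2 A3 p1 p2 p3 \<longleftrightarrow>
     (\<exists>U. unitary_mat n U \<and>
        loewner_le n (U * mat_abs (A1 * A2 * A3) * mat_adjoint U)
          (weighted_powers3 A1 A2 A3 p1 p2 p3))"

definition lin_eig ::
  "nat \<Rightarrow> complex mat \<Rightarrow> complex mat \<Rightarrow> complex mat \<Rightarrow> real \<Rightarrow> real \<Rightarrow> real \<Rightarrow> bool" where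
  "lin_eig n A1 A2 A3 p1 p2 p3 \<longleftrightarrow>
     (\<forall>j \<in> {1..n}. eig j (mat_abs (A1 * A2 * A3)) \<le> eig j (weighted_powers3 A1 A2 A3 p1 p2 p3))"

end

theory Submission
  imports Defs
begin

text \<open>
  The two forms of the conjecture are equivalent because Hermitian matrices are unitarily
  diagonalisable and their ordered eigenvalues are monotone in the Loewner order (min-max).

  For the counterexample, \<open>A\<^sub>1\<close> is the projection onto \<open>(e\<^sub>1 + e\<^sub>3)/\<surd>2\<close> plus a multiple of \<open>e\<^sub>2 e\<^sub>2\<^sup>T\<close>.  Its first
  column has norm \<open>1/\<surd>2\<close>, while the \<open>(1, 1)\<close> entry of \<open>A\<^sub>1\<^sup>3\<^sup>/\<^sup>2\<close> is only \<open>1/2\<close>.  A huge entry \<open>A\<^sub>3(3, 3)\<close>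
  costs nothing in the second eigenvalue of the right-hand side, which is bounded by compressing to
  \<open>e\<^sub>1, e\<^sub>2\<close>.  A small coupling of \<open>e\<^sub>2\<close> and \<open>e\<^sub>3\<close> in \<open>A\<^sub>2\<close> turns it into a large singular value of the
  product, almost orthogonal to the first column.  So the second singular value of the product stays
  close to \<open>1/\<surd>2\<close>, whereas the right-hand side has second eigenvalue at most
  \<open>2/3 \<cdot> 1/2 + 1/6 + 1/6 = 2/3\<close>.
\<close>

subsection \<open>Adjoints, unitary matrices and quadratic forms\<close>

text \<open>In the general closure rule for products the inner dimension does not occur in the
  conclusion. With all dimensions equal to \<open>n\<close>, the rule works as a conditional
  rewrite.\<close>

lemma mult_square_mat_carrier [simp]:
  "A \<in> carrier_mat n n \<Longrightarrow> B \<in> carrier_mat n n \<Longrightarrow> A * B \<in> carrier_mat n n"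
  by auto

lemma mult_square_mat_vec_carrier [simp]:
  "A \<in> carrier_mat n n \<Longrightarrow> v \<in> carrier_vec n \<Longrightarrow> A *\<^sub>v v \<in> carrier_vec n"
  by auto

lemma mat_adjoint_eq_mat:
  "mat_adjoint (A :: complex mat) = mat (dim_col A) (dim_row A) (\<lambda>(i, j). cnj (A $$ (j, i)))"
  by (rule eq_matI) (auto simp: mat_adjoint_def mat_of_rows_def)

lemma mat_adjoint_carrier [simp]:
  "(A :: complex mat) \<in> carrier_mat n m \<Longrightarrow> mat_adjoint A \<in> carrier_mat m n"
  by (auto simp: mat_adjoint_eq_mat)

lemma dim_mat_adjoint [simp]:
  "dim_row (mat_adjoint (A :: complex mat)) = dim_col A"
  "dim_col (mat_adjoint (A :: complex mat)) = dim_row A"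
  by (auto simp: mat_adjoint_eq_mat)

lemma index_mat_adjoint [simp]:
  "i < dim_col A \<Longrightarrow> j < dim_row A \<Longrightarrow> mat_adjoint (A :: complex mat) $$ (i, j) = cnj (A $$ (j, i))"
  by (auto simp: mat_adjoint_eq_mat)

lemma mat_adjoint_adjoint [simp]: "mat_adjoint (mat_adjoint (A :: complex mat)) = A"
  by (rule eq_matI) auto

lemma mat_adjoint_mult:
  assumes "(A :: complex mat) \<in> carrier_mat n m" "B \<in> carrier_mat m k"
  shows "mat_adjoint (A * B) = mat_adjoint B * mat_adjoint A"
  using assms by (intro eq_matI) (auto simp: scalar_prod_def ac_simps)

lemma mat_adjoint_add:
  assumes "(A :: complex mat) \<in> carrier_mat n m" "B \<in> carrier_mat n m"
  shows "mat_adjoint (A + B) = mat_adjoint A + mat_adjoint B"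
  using assms by (intro eq_matI) auto

lemma mat_adjoint_smult:
  "mat_adjoint (c \<cdot>\<^sub>m (A :: complex mat)) = cnj c \<cdot>\<^sub>m mat_adjoint A"
  by (intro eq_matI) auto

lemma mat_adjoint_diag [simp]:
  "mat_adjoint (mat_diag n f :: complex mat) = mat_diag n (\<lambda>i. cnj (f i))"
  by (intro eq_matI) (auto simp: mat_diag_def)

lemma mat_adjoint_one [simp]: "mat_adjoint (1\<^sub>m n :: complex mat) = 1\<^sub>m n"
  by (intro eq_matI) auto

lemma cscalar_prod_adjoint:
  assumes "(A :: complex mat) \<in> carrier_mat n m" "v \<in> carrier_vec m" "w \<in> carrier_vec n"
  shows "(A *\<^sub>v v) \<bullet>c w = v \<bullet>c (mat_adjoint A *\<^sub>v w)"
proof -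
  have "(A *\<^sub>v v) \<bullet>c w = (\<Sum>i<n. (\<Sum>j<m. A $$ (i, j) * v $ j) * cnj (w $ i))"
    using assms by (auto simp: scalar_prod_def atLeast0LessThan)
  also have "\<dots> = (\<Sum>j<m. v $ j * (\<Sum>i<n. A $$ (i, j) * cnj (w $ i)))"
    unfolding sum_distrib_left sum_distrib_right
    by (subst sum.swap) (intro sum.cong refl, simp add: ac_simps)
  also have "\<dots> = v \<bullet>c (mat_adjoint A *\<^sub>v w)"
    using assms by (auto simp: scalar_prod_def atLeast0LessThan)
  finally show ?thesis .
qed

lemma cscalar_prod_self:
  "(v :: complex vec) \<bullet>c v = complex_of_real (\<Sum>i<dim_vec v. (cmod (v $ i))\<^sup>2)"
  by (auto simp: scalar_prod_def atLeast0LessThan complex_norm_square simp del: of_real_power)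

lemma cscalar_prod_diag:
  assumes "(v :: complex vec) \<in> carrier_vec n"
  shows "(mat_diag n (\<lambda>i. complex_of_real (d i)) *\<^sub>v v) \<bullet>c v
    = complex_of_real (\<Sum>i<n. d i * (cmod (v $ i))\<^sup>2)"
proof -
  have "(mat_diag n (\<lambda>i. complex_of_real (d i)) *\<^sub>v v) $ i = complex_of_real (d i) * v $ i"
    if "i < n" for i
  proof -
    have "(mat_diag n (\<lambda>i. complex_of_real (d i)) *\<^sub>v v) $ i
      = (\<Sum>j<n. (if i = j then complex_of_real (d j) else 0) * v $ j)"
      using that assms by (simp add: mat_diag_def scalar_prod_def atLeast0LessThan)
    also have "\<dots> = (\<Sum>j<n. if i = j then complex_of_real (d j) * v $ j else 0)"
      by (intro sum.cong) auto
    finally show ?thesis using that by simp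
  qed
  moreover have "dim_vec (mat_diag n (\<lambda>i. complex_of_real (d i)) *\<^sub>v v) = n"
    by (simp add: mat_diag_def)
  ultimately show ?thesis
    using assms by (auto simp: scalar_prod_def atLeast0LessThan complex_norm_square mult.assoc
        simp del: of_real_power)
qed

lemma hermitian_matD:
  assumes "hermitian_mat n A"
  shows "A \<in> carrier_mat n n" "mat_adjoint A = A"
  using assms by (auto simp: hermitian_mat_def)

lemma psd_matD:
  assumes "psd_mat n A"
  shows "hermitian_mat n A" "A \<in> carrier_mat n n" "mat_adjoint A = A"
    "\<And>v. v \<in> carrier_vec n \<Longrightarrow> 0 \<le> Re ((A *\<^sub>v v) \<bullet>c v)"
  using assms by (auto simp: psd_mat_def hermitian_mat_def)

lemma unitary_matD:
  assumes "unitary_mat n U"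
  shows "U \<in> carrier_mat n n" "mat_adjoint U \<in> carrier_mat n n"
    "mat_adjoint U * U = 1\<^sub>m n" "U * mat_adjoint U = 1\<^sub>m n"
  using assms by (auto simp: unitary_mat_def)

lemma unitary_mat_adjoint: "unitary_mat n U \<Longrightarrow> unitary_mat n (mat_adjoint U)"
  by (auto simp: unitary_mat_def)

lemma unitary_mat_mult:
  assumes "unitary_mat n U" "unitary_mat n V"
  shows "unitary_mat n (U * V)"
proof -
  note U = unitary_matD[OF assms(1)] and V = unitary_matD[OF assms(2)]
  have "mat_adjoint V * mat_adjoint U * (U * V) = mat_adjoint V * ((mat_adjoint U * U) * V)"
    using U(1,2) V(1,2) by (simp add: assoc_mult_mat[of _ n n _ n _ n])
  moreover have "U * V * (mat_adjoint V * mat_adjoint U) = U * ((V * mat_adjoint V) * mat_adjoint U)"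
    using U(1,2) V(1,2) by (simp add: assoc_mult_mat[of _ n n _ n _ n])
  ultimately show ?thesis
    using U V by (auto simp: unitary_mat_def mat_adjoint_mult[of U n n V n])
qed

lemma hermitian_mat_conjugate:
  assumes A: "hermitian_mat n A" and U: "U \<in> carrier_mat n n"
  shows "hermitian_mat n (U * A * mat_adjoint U)"
proof -
  note A = hermitian_matD[OF A]
  have U': "mat_adjoint U \<in> carrier_mat n n" using U by simp
  have "mat_adjoint (U * A * mat_adjoint U) = U * (A * mat_adjoint U)"
    using A U U' by (simp add: mat_adjoint_mult[of _ n n _ n] assoc_mult_mat[of _ n n _ n _ n])
  then show ?thesis
    using A U U' by (simp add: hermitian_mat_def assoc_mult_mat[of _ n n _ n _ n])
qed

section \<open>Unitary diagonalisations with real eigenvalues\<close>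

text \<open>Keeps the diagonaliser \<open>U\<close> and the eigenvalues \<open>d\<close> visible, so
  that forms, products, powers and functions of \<open>A\<close> can all be read off from the same
  data. The values of \<open>d\<close> come in any order, and only those below \<open>n\<close>
  matter.\<close>

definition unitary_diag :: "nat \<Rightarrow> complex mat \<Rightarrow> complex mat \<Rightarrow> (nat \<Rightarrow> real) \<Rightarrow> bool" where
  "unitary_diag n A U d \<longleftrightarrow> unitary_mat n U \<and>
     A = U * mat_diag n (\<lambda>i. complex_of_real (d i)) * mat_adjoint U"

lemma unitary_diagD:
  assumes "unitary_diag n A U d"
  shows "unitary_mat n U" "A = U * mat_diag n (\<lambda>i. complex_of_real (d i)) * mat_adjoint U"
    "U \<in> carrier_mat n n" "A \<in> carrier_mat n n"
  using assms unitary_matD[of n U] by (auto simp: unitary_diag_def)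

lemma unitary_diag_hermitian:
  assumes "unitary_diag n A U d"
  shows "hermitian_mat n A"
  using unitary_diagD[OF assms] hermitian_mat_conjugate[of n "mat_diag n (\<lambda>i. complex_of_real (d i))" U]
  by (simp add: hermitian_mat_def)

text \<open>The coordinates of \<open>v\<close> in the eigenbasis are the entries of
  \<open>U^* v\<close>, and moving \<open>U\<close> across the inner product leaves a diagonal form
  in them.\<close>

lemma unitary_diag_form:
  assumes "unitary_diag n A U d" "v \<in> carrier_vec n"
  shows "Re ((A *\<^sub>v v) \<bullet>c v) = (\<Sum>i<n. d i * (cmod ((mat_adjoint U *\<^sub>v v) $ i))\<^sup>2)"
proof -
  note D = unitary_diagD[OF assms(1)]
  note U = unitary_matD[OF D(1)]
  let ?D = "mat_diag n (\<lambda>i. complex_of_real (d i))" and ?w = "mat_adjoint U *\<^sub>v v"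
  have w: "?w \<in> carrier_vec n" using U(2) assms(2) by (rule mult_square_mat_vec_carrier)
  have "A *\<^sub>v v = U *\<^sub>v (?D *\<^sub>v ?w)"
    unfolding D(2) using U assms(2) w
    by (simp add: assoc_mult_mat_vec[of _ n n _ n])
  then have "(A *\<^sub>v v) \<bullet>c v = (?D *\<^sub>v ?w) \<bullet>c ?w"
    using cscalar_prod_adjoint[OF U(1), of "?D *\<^sub>v ?w" v] assms(2) w
      mult_mat_vec_carrier[OF mat_diag_dim w] by simp
  then show ?thesis using cscalar_prod_diag[OF w] by simp
qed

lemma unitary_mat_norm:
  assumes U: "unitary_mat n U" and v: "v \<in> carrier_vec n"
  shows "(\<Sum>i<n. (cmod ((mat_adjoint U *\<^sub>v v) $ i))\<^sup>2) = (\<Sum>i<n. (cmod (v $ i))\<^sup>2)"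
proof -
  \<comment> \<open>Every unitary diagonalises the identity with all eigenvalues 1; the form of the
    identity is the squared norm.\<close>
  have "unitary_diag n (1\<^sub>m n) U (\<lambda>_. 1)"
    using unitary_matD[OF U] U by (simp add: unitary_diag_def)
  from unitary_diag_form[OF this v] show ?thesis
    using v by (simp add: cscalar_prod_self)
qed

subsection \<open>The spectral theorem\<close>

text \<open>Complete \<open>v\<close> to a basis and orthogonalise. Gram-Schmidt keeps the head
  \<open>v\<close> but does not normalise, so the columns are scaled afterwards; this is where the
  factor \<open>c\<close> comes from.\<close>

lemma ex_unitary_mat_first_col:
  assumes v: "(v :: complex vec) \<in> carrier_vec n" "v \<noteq> 0\<^sub>v n"
  shows "\<exists>U c. unitary_mat n U \<and> col U 0 = c \<cdot>\<^sub>v v"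
proof -
  interpret cof_vec_space n "TYPE(complex)" .
  define b where "b = basis_completion v"
  define ws where "ws = gram_schmidt n b"
  have n: "n \<noteq> 0" using v by (metis carrier_vecD eq_vecI less_nat_zero_code index_zero_vec(2))
  from basis_completion[OF v, folded b_def]
  have span_b: "span (set b) = carrier_vec n" and dist_b: "distinct b"
    and indep: "\<not> lin_dep (set b)" and b: "set b \<subseteq> carrier_vec n" and hdb: "hd b = v"
    and len_b: "length b = n" by auto
  from hdb len_b n obtain vs where bv: "b = v # vs" by (cases b) auto
  from gram_schmidt_result[OF b dist_b indep refl, folded ws_def]
  have ws: "set ws \<subseteq> carrier_vec n" "corthogonal ws" "length ws = n"
    by (auto simp: len_b)
  from gram_schmidt_hd[OF v(1), of vs, folded bv] have "hd ws = v" unfolding ws_def .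
  then have ws0: "ws ! 0 = v" using ws(3) n by (cases ws) auto
  have wsc: "ws ! j \<in> carrier_vec n" if "j < n" for j using that ws by auto
  define N where "N j = (\<Sum>i<n. (cmod (ws ! j $ i))\<^sup>2)" for j
  have self: "ws ! j \<bullet>c ws ! j = complex_of_real (N j)" if "j < n" for j
    using wsc[OF that] by (simp add: cscalar_prod_self N_def)
  have N: "N j > 0" if "j < n" for j
  proof -
    have "ws ! j \<bullet>c ws ! j \<noteq> 0" using corthogonalD[OF ws(2), of j j] that ws(3) by auto
    then have "N j \<noteq> 0" using self[OF that] by auto
    moreover have "N j \<ge> 0" by (auto simp: N_def intro: sum_nonneg)
    ultimately show ?thesis by simp
  qed
  define U where "U = mat n n (\<lambda>(i, j). ws ! j $ i / complex_of_real (sqrt (N j)))"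
  have U: "U \<in> carrier_mat n n" by (simp add: U_def)
  have UU: "mat_adjoint U * U = 1\<^sub>m n"
  proof (rule eq_matI)
    fix i j assume ij: "i < dim_row (1\<^sub>m n :: complex mat)" "j < dim_col (1\<^sub>m n :: complex mat)"
    then have ij': "i < n" "j < n" by auto
    have "(mat_adjoint U * U) $$ (i, j) = (\<Sum>k<n. cnj (U $$ (k, i)) * U $$ (k, j))"
      using ij' U by (auto simp: scalar_prod_def atLeast0LessThan)
    also have "\<dots> = (ws ! j \<bullet>c ws ! i) / complex_of_real (sqrt (N i) * sqrt (N j))"
      using ij' wsc[of i] wsc[of j]
      by (auto simp: U_def scalar_prod_def atLeast0LessThan sum_divide_distrib ac_simps intro!: sum.cong)
    also have "\<dots> = (if i = j then 1 else 0)"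
      using corthogonalD[OF ws(2), of j i] ij' ws(3) self[of i] N[of i]
      by (auto simp flip: of_real_mult)
    finally show "(mat_adjoint U * U) $$ (i, j) = 1\<^sub>m n $$ (i, j)" using ij' by simp
  qed (use U in auto)
  have "col U 0 = (1 / complex_of_real (sqrt (N 0))) \<cdot>\<^sub>v v"
    using n v by (intro eq_vecI) (auto simp: U_def ws0)
  moreover have "unitary_mat n U"
    using U UU mat_mult_left_right_inverse[OF mat_adjoint_carrier[OF U] U UU]
    by (simp add: unitary_mat_def)
  ultimately show ?thesis by blast
qed

lemma mat_adjoint_four_block:
  assumes "(A :: complex mat) \<in> carrier_mat a b" "B \<in> carrier_mat a d" "C \<in> carrier_mat c b" "D \<in> carrier_mat c d"
  shows "mat_adjoint (four_block_mat A B C D)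
    = four_block_mat (mat_adjoint A) (mat_adjoint C) (mat_adjoint B) (mat_adjoint D)"
  using assms by (intro eq_matI) (auto simp: index_mat_four_block)

lemma mult_block_diag_mat:
  assumes "(A :: complex mat) \<in> carrier_mat k k" "C \<in> carrier_mat k k"
    "B \<in> carrier_mat m m" "D \<in> carrier_mat m m"
  shows "four_block_mat A (0\<^sub>m k m) (0\<^sub>m m k) B * four_block_mat C (0\<^sub>m k m) (0\<^sub>m m k) D
    = four_block_mat (A * C) (0\<^sub>m k m) (0\<^sub>m m k) (B * D)"
  using assms
  by (simp add: mult_four_block_mat[OF assms(1) zero_carrier_mat zero_carrier_mat assms(3)
        assms(2) zero_carrier_mat zero_carrier_mat assms(4)])

lemma unitary_conj_cancel:
  assumes U: "unitary_mat n U" and A: "A \<in> carrier_mat n n"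
  shows "U * (mat_adjoint U * A * U) * mat_adjoint U = A"
proof -
  note U = unitary_matD[OF U]
  have eq: "U * (mat_adjoint U * A * U) * mat_adjoint U = (U * mat_adjoint U) * A * (U * mat_adjoint U)"
    using U(1,2) A by (simp add: assoc_mult_mat[of _ n n _ n _ n])
  show ?thesis unfolding eq using U A by simp
qed

text \<open>Deflation, by induction on the list of roots: conjugate by a unitary whose first column
  is an eigenvector for \<open>e\<close>, split off that coordinate and recurse on the rest. The
  diagonal follows the given order of \<open>es\<close>, so a sorted list yields sorted eigenvalues.
  The roots are complex here; that they are real is a consequence of this lemma.\<close>

lemma hermitian_schur:
  assumes "hermitian_mat n A" "char_poly A = (\<Prod>e\<leftarrow>es. [:- e, 1:])"
  shows "\<exists>U. unitary_mat n U \<and> A = U * mat_diag n (\<lambda>i. es ! i) * mat_adjoint U"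
  using assms
proof (induction es arbitrary: n A)
  case Nil
  then have A: "A \<in> carrier_mat n n" by (simp add: hermitian_mat_def)
  from degree_monic_char_poly[OF A] Nil have n: "n = 0" by simp
  have "unitary_mat n (1\<^sub>m n)" by (simp add: unitary_mat_def)
  moreover have "A = 1\<^sub>m n * mat_diag n (\<lambda>i. [] ! i) * mat_adjoint (1\<^sub>m n)"
    using A n by (intro eq_matI) auto
  ultimately show ?case by blast
next
  case (Cons e es n A)
  note A = hermitian_matD[OF Cons.prems(1)]
  have cp: "char_poly A = [:- e, 1:] * (\<Prod>e\<leftarrow>es. [:- e, 1:])" using Cons.prems by simp
  have "degree (char_poly A) = Suc (degree (\<Prod>e\<leftarrow>es. [:- e, 1:]))"
    unfolding cp by (subst degree_mult_eq) (auto intro!: monic_prod_list simp: prod_list_zero_iff)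
  then obtain m where n: "n = Suc m" using degree_monic_char_poly[OF A(1)] by simp
  have "eigenvalue A e" unfolding eigenvalue_root_char_poly[OF A(1)] cp by simp
  then obtain v where v: "v \<in> carrier_vec n" "v \<noteq> 0\<^sub>v n" and Av: "A *\<^sub>v v = e \<cdot>\<^sub>v v"
    using A by (auto simp: eigenvalue_def eigenvector_def)
  obtain U c where U: "unitary_mat n U" and c: "col U 0 = c \<cdot>\<^sub>v v"
    using ex_unitary_mat_first_col[OF v] by blast
  note U' = unitary_matD[OF U]
  define A' where "A' = mat_adjoint U * A * U"
  have A'c: "A' \<in> carrier_mat n n" using A U' by (simp add: A'_def)
  have A'h: "hermitian_mat n A'"
    using hermitian_mat_conjugate[OF Cons.prems(1) U'(2)] by (simp add: A'_def)
  have col0: "A' $$ (i, 0) = (if i = 0 then e else 0)" if "i < n" for i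
  proof -
    have Ac: "A *\<^sub>v col U 0 = e \<cdot>\<^sub>v col U 0"
      using A v Av by (simp add: c mult_mat_vec[of _ n n] smult_smult_assoc mult.commute)
    have "A' $$ (i, 0) = (mat_adjoint U * (A * U)) $$ (i, 0)"
      using A U' by (simp add: A'_def assoc_mult_mat[of _ n n _ n _ n])
    also have "\<dots> = row (mat_adjoint U) i \<bullet> (A *\<^sub>v col U 0)"
      using A U' that n col_mult2[of A n n U n 0] by simp
    also have "\<dots> = e * (mat_adjoint U * U) $$ (i, 0)"
      using U'(1,2) that n by (simp add: Ac scalar_prod_smult_distrib[of _ n])
    also have "\<dots> = (if i = 0 then e else 0)"
      unfolding U'(3) using that n by simp
    finally show ?thesis .
  qed
  have adj: "A' $$ (j, i) = cnj (A' $$ (i, j))" if "i < n" "j < n" for i j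
    using hermitian_matD[OF A'h] that A'c by (metis carrier_matD index_mat_adjoint)
  \<comment> \<open>Hermitian symmetry carries the zeros of the first column over to the first row,
    so the block form is diagonal and not just triangular.\<close>
  have row0: "A' $$ (0, i) = (if i = 0 then e else 0)" if "i < n" for i
    using col0[OF that] adj[of i 0] that n by auto
  define A3 where "A3 = mat m m (\<lambda>(i, j). A' $$ (Suc i, Suc j))"
  have A3: "A3 \<in> carrier_mat m m" by (simp add: A3_def)
  have A3h: "hermitian_mat m A3"
    unfolding hermitian_mat_def using A3 adj[symmetric] n by (auto intro!: eq_matI simp: A3_def)
  define E where "E = mat 1 1 (\<lambda>_. e)"
  have E: "E \<in> carrier_mat 1 1" by (simp add: E_def)
  have block: "A' = four_block_mat E (0\<^sub>m 1 m) (0\<^sub>m m 1) A3"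
    using A'c n col0 row0 by (intro eq_matI) (auto simp: E_def A3_def index_mat_four_block)
  have A_eq: "A = U * A' * mat_adjoint U"
    using unitary_conj_cancel[OF U A(1)] by (simp add: A'_def)
  have "similar_mat_wit A A' U (mat_adjoint U)"
    using A A'c U' A_eq by (intro similar_mat_witI[of _ _ n]) auto
  then have "char_poly A = char_poly A'"
    by (intro char_poly_similar) (auto simp: similar_mat_def)
  also have "\<dots> = char_poly E * char_poly A3"
    unfolding block by (rule char_poly_four_block_zeros_col[OF E _ A3]) simp
  also have "char_poly E = [:- e, 1:]"
    by (simp add: E_def char_poly_defs det_def sign_def)
  \<comment> \<open>Cancelling the common linear factor leaves exactly the shorter list that the
    induction hypothesis expects.\<close>
  finally have "char_poly A3 = (\<Prod>e\<leftarrow>es. [:- e, 1:])"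
    using cp by (metis mult_cancel_left pCons_eq_0_iff zero_neq_one)
  from Cons.IH[OF A3h this] obtain V
    where V: "unitary_mat m V" and A3V: "A3 = V * mat_diag m (\<lambda>i. es ! i) * mat_adjoint V" by blast
  note V' = unitary_matD[OF V]
  \<comment> \<open>The diagonaliser \<open>V\<close> of the smaller block, extended by 1 in the
    split-off coordinate; \<open>U * T\<close> then diagonalises \<open>A\<close>.\<close>
  define T where "T = four_block_mat (1\<^sub>m 1) (0\<^sub>m 1 m) (0\<^sub>m m 1) V"
  have Tadj: "mat_adjoint T = four_block_mat (1\<^sub>m 1) (0\<^sub>m 1 m) (0\<^sub>m m 1) (mat_adjoint V)"
    unfolding T_def using V' by (subst mat_adjoint_four_block[of _ 1 1 _ m _ m]) (auto intro!: eq_matI)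
  have one: "four_block_mat (1\<^sub>m 1) (0\<^sub>m 1 m) (0\<^sub>m m 1) (1\<^sub>m m) = (1\<^sub>m n :: complex mat)"
    using n by (intro eq_matI) (auto simp: index_mat_four_block)
  have T: "unitary_mat n T"
    unfolding unitary_mat_def Tadj unfolding T_def using V' n one
    by (auto simp: mult_block_diag_mat)
  have D: "mat_diag n (\<lambda>i. (e # es) ! i) = four_block_mat E (0\<^sub>m 1 m) (0\<^sub>m m 1) (mat_diag m (\<lambda>i. es ! i))"
    using n by (intro eq_matI) (auto simp: index_mat_four_block mat_diag_def E_def nth_Cons')
  have "A' = T * mat_diag n (\<lambda>i. (e # es) ! i) * mat_adjoint T"
    unfolding Tadj D unfolding T_def block A3V using V'(1,2) E
      mult_square_mat_carrier[OF V'(1) mat_diag_dim, of "\<lambda>i. es ! i"]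
      left_mult_one_mat[OF E] right_mult_one_mat[OF E]
    by (simp add: mult_block_diag_mat del: One_nat_def)
  then have "A = U * (T * mat_diag n (\<lambda>i. (e # es) ! i) * mat_adjoint T) * mat_adjoint U"
    using A_eq by simp
  also have "\<dots> = U * T * mat_diag n (\<lambda>i. (e # es) ! i) * mat_adjoint (U * T)"
    using U' unitary_matD[OF T] mat_diag_dim[of n "\<lambda>i. (e # es) ! i"]
    by (simp add: mat_adjoint_mult[of U n n T n] assoc_mult_mat[of _ n n _ n _ n])
  finally show ?case using unitary_mat_mult[OF U T] by blast
qed

text \<open>The diagonal matrix equals \<open>U^* A U\<close>, so it is Hermitian and each of its
  entries is its own conjugate.\<close>

lemma hermitian_eigenvalue_real:
  assumes A: "hermitian_mat n A" and U: "unitary_mat n U"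
    and eq: "A = U * mat_diag n f * mat_adjoint U" and i: "i < n"
  shows "f i \<in> \<real>"
proof -
  note U' = unitary_matD[OF U] and A' = hermitian_matD[OF A]
  have "mat_diag n f = mat_adjoint U * A * U"
    using unitary_conj_cancel[OF unitary_mat_adjoint[OF U] mat_diag_dim, of f] by (simp add: eq)
  then have "hermitian_mat n (mat_diag n f)"
    using hermitian_mat_conjugate[OF A U'(2)] by simp
  then have "mat_diag n (\<lambda>i. cnj (f i)) $$ (i, i) = mat_diag n f $$ (i, i)"
    using hermitian_matD(2) by fastforce
  then show ?thesis using i by (simp add: mat_diag_def Reals_cnj_iff)
qed

lemma eigs_unitary_conj:
  assumes U: "unitary_mat n U" and A: "A \<in> carrier_mat n n"
  shows "eigs (U * A * mat_adjoint U) = eigs A"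
proof -
  note U' = unitary_matD[OF U]
  have "similar_mat_wit (U * A * mat_adjoint U) A U (mat_adjoint U)"
    using A U' by (intro similar_mat_witI[of _ _ n]) auto
  then have "char_poly (U * A * mat_adjoint U) = char_poly A"
    by (intro char_poly_similar) (auto simp: similar_mat_def)
  then show ?thesis by (simp add: eigs_def)
qed

text \<open>The spectral theorem, with a decreasing diagonal tied to \<open>eig\<close>.
  \<open>hermitian_schur\<close> is applied twice: first to an arbitrary enumeration of the roots,
  which shows that they are real, then to the sorted list \<open>eigs A\<close>.\<close>

lemma ex_unitary_diag:
  assumes A: "hermitian_mat n A"
  shows "\<exists>U d. unitary_diag n A U d \<and> (\<forall>i j. i \<le> j \<longrightarrow> j < n \<longrightarrow> d j \<le> d i)
    \<and> (\<forall>j\<in>{1..n}. eig j A = d (j - 1))"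
proof -
  note A' = hermitian_matD[OF A]
  define M where "M = proots (char_poly A)"
  have M: "char_poly A = (\<Prod>e\<in>#M. [:- e, 1:])"
    using degree_monic_char_poly[OF A'(1)] complex_poly_decompose_multiset[of "char_poly A"]
    by (simp add: M_def)
  have sz: "size M = n"
    using degree_monic_char_poly[OF A'(1)] by (simp add: M_def size_proots_complex)
  define es where "es = map complex_of_real (eigs A)"
  have real: "e \<in> \<real>" if "e \<in># M" for e
  proof -
    obtain xs where xs: "mset xs = M" using ex_mset by blast
    then have "char_poly A = (\<Prod>e\<leftarrow>xs. [:- e, 1:])" using M by (simp flip: prod_mset_prod_list)
    from hermitian_schur[OF A this] obtain U where U: "unitary_mat n U"
      "A = U * mat_diag n (\<lambda>i. xs ! i) * mat_adjoint U" by blast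
    have "length xs = n" using sz xs by (metis size_mset)
    then show ?thesis using hermitian_eigenvalue_real[OF A U] that xs by (metis in_set_conv_nth set_mset_mset)
  qed
  have "mset es = image_mset (\<lambda>e. complex_of_real (Re e)) M"
    by (simp add: es_def eigs_def M_def image_mset.compositionality o_def)
  also have "\<dots> = image_mset (\<lambda>e. e) M"
    using real by (intro image_mset_cong) auto
  finally have es: "mset es = M" by simp
  then have "char_poly A = (\<Prod>e\<leftarrow>es. [:- e, 1:])" using M by (simp flip: prod_mset_prod_list)
  from hermitian_schur[OF A this] obtain U where U: "unitary_mat n U"
    "A = U * mat_diag n (\<lambda>i. es ! i) * mat_adjoint U" by blast
  have len: "length (eigs A) = n" using es sz by (metis es_def length_map size_mset)
  have "mat_diag n (\<lambda>i. es ! i) = mat_diag n (\<lambda>i. complex_of_real (eigs A ! i))"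
    by (intro eq_matI) (auto simp: mat_diag_def es_def len)
  then have "unitary_diag n A U (\<lambda>i. eigs A ! i)" using U by (simp add: unitary_diag_def)
  moreover have "eigs A ! j \<le> eigs A ! i" if "i \<le> j" "j < n" for i j
  proof -
    have "sorted (rev (eigs A))" by (simp add: eigs_def)
    then show ?thesis using that len by (simp add: sorted_rev_nth_mono)
  qed
  ultimately show ?thesis by (intro exI[of _ U] exI[of _ "\<lambda>i. eigs A ! i"]) (auto simp: eig_def)
qed

subsection \<open>Functional calculus and absolute value\<close>

text \<open>Entrywise the hypothesis says \<open>W_ij (d_j - e_i) = 0\<close>. Where
  \<open>W_ij\<close> is nonzero, \<open>d_j = e_i\<close> and hence
  \<open>f (d_j) = f (e_i)\<close>.\<close>

lemma mat_diag_intertwine: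
  assumes W: "W \<in> carrier_mat n n"
    and eq: "W * mat_diag n (\<lambda>i. complex_of_real (d i)) = mat_diag n (\<lambda>i. complex_of_real (e i)) * W"
  shows "W * mat_diag n (\<lambda>i. complex_of_real (f (d i))) = mat_diag n (\<lambda>i. complex_of_real (f (e i))) * W"
proof (rule eq_matI)
  fix i j assume "i < dim_row (mat_diag n (\<lambda>i. complex_of_real (f (e i))) * W)"
    "j < dim_col (mat_diag n (\<lambda>i. complex_of_real (f (e i))) * W)"
  then have ij: "i < n" "j < n" using W by (auto simp: mat_diag_def)
  from arg_cong[OF eq, of "\<lambda>X. X $$ (i, j)"] have "W $$ (i, j) = 0 \<or> d j = e i"
    using W ij by (simp add: mat_diag_mult_left[OF W] mat_diag_mult_right[OF W])
  then show "(W * mat_diag n (\<lambda>i. complex_of_real (f (d i)))) $$ (i, j)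
    = (mat_diag n (\<lambda>i. complex_of_real (f (e i))) * W) $$ (i, j)"
    using W ij by (auto simp: mat_diag_mult_left[OF W] mat_diag_mult_right[OF W])
qed (use W in \<open>auto simp: mat_diag_def\<close>)

text \<open>The functional calculus is well defined: \<open>W = V^* U\<close> intertwines the two
  diagonals, hence also their images under \<open>f\<close>. This supplies the uniqueness demanded
  by the \<open>THE\<close> in \<open>mat_fun\<close>.\<close>

lemma unitary_diag_fun_unique:
  assumes "unitary_diag n A U d" "unitary_diag n A V e"
  shows "U * mat_diag n (\<lambda>i. complex_of_real (f (d i))) * mat_adjoint U
       = V * mat_diag n (\<lambda>i. complex_of_real (f (e i))) * mat_adjoint V"
proof -
  note U = unitary_diagD[OF assms(1)] and V = unitary_diagD[OF assms(2)]
  note U' = unitary_matD[OF U(1)] and V' = unitary_matD[OF V(1)]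
  define W where "W = mat_adjoint V * U"
  have W: "W \<in> carrier_mat n n" using U' V' by (simp add: W_def)
  have VW: "V * W = U"
    using U' V' by (simp add: W_def assoc_mult_mat[of V n n _ n _ n, symmetric])
  have cancelV: "mat_adjoint V * (V * X) = X" if "X \<in> carrier_mat n n" for X
    using V' that by (simp add: assoc_mult_mat[of _ n n _ n _ n, symmetric])
  have cancelU: "X * mat_adjoint U * U = X" if "X \<in> carrier_mat n n" for X
    using U' that by (simp add: assoc_mult_mat[of _ n n _ n _ n])
  have cancelU': "X * U * mat_adjoint U = X" if "X \<in> carrier_mat n n" for X
    using U' that by (simp add: assoc_mult_mat[of _ n n _ n _ n])
  let ?D = "\<lambda>d. mat_diag n (\<lambda>i. complex_of_real (d i))"
  have "W * ?D d = mat_adjoint V * (U * ?D d * mat_adjoint U) * U"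
    using U' V' cancelU[of "mat_adjoint V * (U * ?D d)"]
    by (simp add: W_def assoc_mult_mat[of _ n n _ n _ n])
  also have "\<dots> = mat_adjoint V * (V * ?D e * mat_adjoint V) * U"
    using U(2) V(2) by simp
  also have "\<dots> = ?D e * W"
    using U' V' cancelV by (simp add: W_def assoc_mult_mat[of _ n n _ n _ n])
  finally have "W * ?D (\<lambda>i. f (d i)) = ?D (\<lambda>i. f (e i)) * W"
    by (rule mat_diag_intertwine[OF W])
  then have "V * (W * ?D (\<lambda>i. f (d i))) * mat_adjoint U = V * (?D (\<lambda>i. f (e i)) * W) * mat_adjoint U"
    by simp
  moreover have "V * (W * ?D (\<lambda>i. f (d i))) = U * ?D (\<lambda>i. f (d i))"
    using W V' VW by (simp add: assoc_mult_mat[of _ n n _ n _ n, symmetric])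
  moreover have "V * (?D (\<lambda>i. f (e i)) * W) * mat_adjoint U = V * ?D (\<lambda>i. f (e i)) * mat_adjoint V"
    using U' V' cancelU' by (simp add: W_def assoc_mult_mat[of _ n n _ n _ n, symmetric])
  ultimately show ?thesis by simp
qed

lemma mat_fun_eq:
  assumes "unitary_diag n A U d"
  shows "mat_fun f A = U * mat_diag n (\<lambda>i. complex_of_real (f (d i))) * mat_adjoint U"
proof -
  have n: "dim_row A = n" using unitary_diagD[OF assms] by auto
  show ?thesis unfolding mat_fun_def n
  proof (rule the_equality)
    show "\<exists>V e. unitary_mat n V \<and> A = V * mat_diag n (\<lambda>i. complex_of_real (e i)) * mat_adjoint V \<and>
      U * mat_diag n (\<lambda>i. complex_of_real (f (d i))) * mat_adjoint U
        = V * mat_diag n (\<lambda>i. complex_of_real (f (e i))) * mat_adjoint V"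
      using assms by (auto simp: unitary_diag_def)
  next
    fix B assume "\<exists>V e. unitary_mat n V \<and> A = V * mat_diag n (\<lambda>i. complex_of_real (e i)) * mat_adjoint V \<and>
      B = V * mat_diag n (\<lambda>i. complex_of_real (f (e i))) * mat_adjoint V"
    then obtain V e where "unitary_diag n A V e"
      "B = V * mat_diag n (\<lambda>i. complex_of_real (f (e i))) * mat_adjoint V"
      by (auto simp: unitary_diag_def)
    then show "B = U * mat_diag n (\<lambda>i. complex_of_real (f (d i))) * mat_adjoint U"
      using unitary_diag_fun_unique[OF _ assms] by blast
  qed
qed

lemma hermitian_mat_fun:
  assumes "hermitian_mat n A"
  shows "hermitian_mat n (mat_fun f A)"
proof -
  obtain U d where D: "unitary_diag n A U d" using ex_unitary_diag[OF assms] by blast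
  then have "unitary_diag n (mat_fun f A) U (\<lambda>i. f (d i))"
    using mat_fun_eq[OF D] by (simp add: unitary_diag_def)
  then show ?thesis by (rule unitary_diag_hermitian)
qed

lemma unitary_diag_mult:
  assumes "unitary_diag n A U d" "unitary_diag n B U e"
  shows "unitary_diag n (A * B) U (\<lambda>i. d i * e i)"
proof -
  note U = unitary_diagD[OF assms(1)] unitary_diagD[OF assms(2)]
  note U' = unitary_matD[OF U(1)]
  let ?D = "\<lambda>d. mat_diag n (\<lambda>i. complex_of_real (d i))"
  have "A * B = U * (?D d * (mat_adjoint U * U) * ?D e) * mat_adjoint U"
    unfolding U(2) U(6) using U'(1,2) by (simp add: assoc_mult_mat[of _ n n _ n _ n])
  also have "?D d * (mat_adjoint U * U) * ?D e = ?D (\<lambda>i. d i * e i)"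
    unfolding U'(3) by (simp add: right_mult_one_mat[OF mat_diag_dim])
  finally show ?thesis using U(1) by (simp add: unitary_diag_def)
qed

lemma psd_unitary_diag_iff:
  assumes D: "unitary_diag n A U d"
  shows "psd_mat n A \<longleftrightarrow> (\<forall>i<n. 0 \<le> d i)"
proof
  note U = unitary_matD[OF unitary_diagD(1)[OF D]]
  assume A: "psd_mat n A"
  show "\<forall>i<n. 0 \<le> d i"
  proof (intro allI impI)
    fix i assume i: "i < n"
    \<comment> \<open>The \<open>i\<close>-th eigenvector; its form isolates
      \<open>d i\<close>.\<close>
    let ?v = "U *\<^sub>v unit_vec n i"
    have "mat_adjoint U *\<^sub>v ?v = unit_vec n i"
      using U by (simp add: assoc_mult_mat_vec[of _ n n _ n, symmetric])
    then have "Re ((A *\<^sub>v ?v) \<bullet>c ?v) = (\<Sum>j<n. d j * (cmod (unit_vec n i $ j))\<^sup>2)"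
      using unitary_diag_form[OF D, of ?v] U by simp
    also have "\<dots> = (\<Sum>j<n. if j = i then d i else 0)"
      using i by (intro sum.cong) auto
    finally show "0 \<le> d i" using psd_matD(4)[OF A, of ?v] U i by simp
  qed
next
  assume "\<forall>i<n. 0 \<le> d i"
  then show "psd_mat n A" unfolding psd_mat_def
    using unitary_diag_hermitian[OF D] unitary_diag_form[OF D] by (auto intro!: sum_nonneg)
qed

lemma psd_adjoint_mult:
  assumes "X \<in> carrier_mat m n"
  shows "psd_mat n (mat_adjoint X * X)"
proof -
  have "Re ((mat_adjoint X * X *\<^sub>v v) \<bullet>c v) \<ge> 0" if "v \<in> carrier_vec n" for v
  proof -
    have "(mat_adjoint X * X *\<^sub>v v) \<bullet>c v = (mat_adjoint X *\<^sub>v (X *\<^sub>v v)) \<bullet>c v"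
      using assms that by (subst assoc_mult_mat_vec[of _ n m _ n]) auto
    also have "\<dots> = (X *\<^sub>v v) \<bullet>c (X *\<^sub>v v)"
      using assms that cscalar_prod_adjoint[of "mat_adjoint X" n m "X *\<^sub>v v" v] by simp
    finally show ?thesis by (simp add: cscalar_prod_self sum_nonneg)
  qed
  then show ?thesis using assms
    by (auto simp: psd_mat_def hermitian_mat_def mat_adjoint_mult[of _ n m _ n])
qed

text \<open>Diagonalise \<open>P\<close> rather than \<open>A\<close>: the same \<open>U\<close>
  diagonalises \<open>A = P * P\<close> with eigenvalues \<open>d_i^2\<close>, and
  \<open>sqrt\<close> recovers \<open>d_i\<close> because \<open>d_i\<close> is nonnegative.\<close>

lemma psd_sqrt_unique:
  assumes P: "psd_mat n P" "P * P = A"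
  shows "P = mat_fun sqrt A"
proof -
  obtain U d where D: "unitary_diag n P U d" using ex_unitary_diag[OF psd_matD(1)[OF P(1)]] by blast
  have d: "\<forall>i<n. 0 \<le> d i" using P(1) psd_unitary_diag_iff[OF D] by blast
  have "unitary_diag n A U (\<lambda>i. d i * d i)" using unitary_diag_mult[OF D D] P by simp
  from mat_fun_eq[OF this, of sqrt] have "mat_fun sqrt A
    = U * mat_diag n (\<lambda>i. complex_of_real (sqrt (d i * d i))) * mat_adjoint U" .
  also have "mat_diag n (\<lambda>i. complex_of_real (sqrt (d i * d i))) = mat_diag n (\<lambda>i. complex_of_real (d i))"
    using d by (intro eq_matI) (auto simp: mat_diag_def)
  finally show ?thesis using unitary_diagD(2)[OF D] by simp
qed

text \<open>Makes the \<open>THE\<close> in the definition usable: existence comes from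
  \<open>mat_fun sqrt\<close>, uniqueness from \<open>psd_sqrt_unique\<close>.\<close>

lemma mat_abs:
  assumes "X \<in> carrier_mat n n"
  shows "psd_mat n (mat_abs X)" "mat_abs X * mat_abs X = mat_adjoint X * X"
proof -
  define A where "A = mat_adjoint X * X"
  have A: "psd_mat n A" unfolding A_def by (rule psd_adjoint_mult[OF assms])
  obtain U d where D: "unitary_diag n A U d" using ex_unitary_diag[OF psd_matD(1)[OF A]] by blast
  have d: "\<forall>i<n. 0 \<le> d i" using A psd_unitary_diag_iff[OF D] by blast
  define P where "P = mat_fun sqrt A"
  have DP: "unitary_diag n P U (\<lambda>i. sqrt (d i))"
    using mat_fun_eq[OF D, of sqrt] D by (simp add: unitary_diag_def P_def)
  have P: "psd_mat n P" using psd_unitary_diag_iff[OF DP] d by simp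
  have "mat_diag n (\<lambda>i. complex_of_real (sqrt (d i) * sqrt (d i))) = mat_diag n (\<lambda>i. complex_of_real (d i))"
    using d by (intro eq_matI) (auto simp: mat_diag_def simp flip: of_real_mult)
  then have PP: "P * P = A"
    using unitary_diagD(2)[OF unitary_diag_mult[OF DP DP]] unitary_diagD(2)[OF D] by simp
  have n: "dim_col X = n" using assms by simp
  have "mat_abs X = P" unfolding mat_abs_def n
  proof (rule the_equality)
    show "psd_mat n P \<and> P * P = mat_adjoint X * X" using P PP by (simp add: A_def)
    fix Q assume "psd_mat n Q \<and> Q * Q = mat_adjoint X * X"
    then show "Q = P" unfolding P_def A_def by (intro psd_sqrt_unique) auto
  qed
  then show "psd_mat n (mat_abs X)" "mat_abs X * mat_abs X = mat_adjoint X * X"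
    using P PP by (auto simp: A_def)
qed

subsection \<open>The min-max principle\<close>

text \<open>Stacking the first \<open>k\<close> rows of \<open>G\<close>, a zero row and the last \<open>n - k - 1\<close> rows of \<open>F\<close> gives
  a singular matrix; this replaces the dimension count in the min-max principle.\<close>

lemma ex_vec_common_kernel:
  assumes F: "(F :: complex mat) \<in> carrier_mat n n" and G: "G \<in> carrier_mat n n" and k: "k < n"
  shows "\<exists>v \<in> carrier_vec n. v \<noteq> 0\<^sub>v n \<and> (\<forall>i<n. k < i \<longrightarrow> (F *\<^sub>v v) $ i = 0) \<and> (\<forall>i<k. (G *\<^sub>v v) $ i = 0)"
proof -
  define M where "M = mat\<^sub>r n n (\<lambda>i. if i = k then 0\<^sub>v n else if i < k then row G i else row F i)"
  have M: "M \<in> carrier_mat n n" by (simp add: M_def)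
  have "det M = 0"
    unfolding M_def using F G by (intro det_row_0[OF k]) auto
  then obtain v where v: "v \<in> carrier_vec n" "v \<noteq> 0\<^sub>v n" and Mv: "M *\<^sub>v v = 0\<^sub>v n"
    using det_0_iff_vec_prod_zero_field[OF M] by blast
  have rows: "row M i \<bullet> v = 0" if "i < n" for i
    using arg_cong[OF Mv, of "\<lambda>w. w $ i"] that M by simp
  have "(F *\<^sub>v v) $ i = 0" if "i < n" "k < i" for i
    using rows[of i] that F by (simp add: M_def)
  moreover have "(G *\<^sub>v v) $ i = 0" if "i < k" for i
    using rows[of i] that G k by (simp add: M_def)
  ultimately show ?thesis using v by blast
qed

definition vnorm2 :: "complex vec \<Rightarrow> real" where
  "vnorm2 v = (\<Sum>i<dim_vec v. (cmod (v $ i))\<^sup>2)"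

lemma vnorm2_pos:
  assumes "v \<in> carrier_vec n" "v \<noteq> 0\<^sub>v n"
  shows "vnorm2 v > 0"
proof -
  from assms obtain i where "i < n" "v $ i \<noteq> 0" by (metis carrier_vecD eq_vecI index_zero_vec)
  then show ?thesis using assms unfolding vnorm2_def by (intro sum_pos2[of _ i]) auto
qed

text \<open>The last hypothesis places \<open>v\<close> in the span of the eigenvectors whose
  eigenvalue is at least \<open>c\<close>. The next lemma is the mirror image.\<close>

lemma unitary_diag_form_ge:
  assumes D: "unitary_diag n A U d" and v: "v \<in> carrier_vec n"
    and c: "\<And>i. i < n \<Longrightarrow> (mat_adjoint U *\<^sub>v v) $ i = 0 \<or> c \<le> d i"
  shows "c * vnorm2 v \<le> Re ((A *\<^sub>v v) \<bullet>c v)"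
proof -
  have "c * vnorm2 v = (\<Sum>i<n. c * (cmod ((mat_adjoint U *\<^sub>v v) $ i))\<^sup>2)"
    using unitary_mat_norm[OF unitary_diagD(1)[OF D] v] v by (simp add: vnorm2_def sum_distrib_left[symmetric])
  also have "\<dots> \<le> (\<Sum>i<n. d i * (cmod ((mat_adjoint U *\<^sub>v v) $ i))\<^sup>2)"
    using c by (intro sum_mono) (fastforce intro: mult_right_mono)
  finally show ?thesis using unitary_diag_form[OF D v] by simp
qed

lemma unitary_diag_form_le:
  assumes D: "unitary_diag n A U d" and v: "v \<in> carrier_vec n"
    and c: "\<And>i. i < n \<Longrightarrow> (mat_adjoint U *\<^sub>v v) $ i = 0 \<or> d i \<le> c"
  shows "Re ((A *\<^sub>v v) \<bullet>c v) \<le> c * vnorm2 v"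
proof -
  have "(\<Sum>i<n. d i * (cmod ((mat_adjoint U *\<^sub>v v) $ i))\<^sup>2) \<le> (\<Sum>i<n. c * (cmod ((mat_adjoint U *\<^sub>v v) $ i))\<^sup>2)"
    using c by (intro sum_mono) (fastforce intro: mult_right_mono)
  also have "\<dots> = c * vnorm2 v"
    using unitary_mat_norm[OF unitary_diagD(1)[OF D] v] v by (simp add: vnorm2_def sum_distrib_left[symmetric])
  finally show ?thesis using unitary_diag_form[OF D v] by simp
qed

text \<open>Upper half of min-max. The test space is the kernel of the first \<open>j - 1\<close>
  rows of \<open>G\<close>, so it meets the span of the first \<open>j\<close> eigenvectors of
  \<open>A\<close> in a nonzero vector; the other rows of \<open>G\<close> are arbitrary.\<close>

lemma eig_le:
  assumes A: "hermitian_mat n A" and G: "G \<in> carrier_mat n n" and j: "j \<in> {1..n}"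
    and form: "\<And>v. v \<in> carrier_vec n \<Longrightarrow> (\<And>i. i < j - 1 \<Longrightarrow> (G *\<^sub>v v) $ i = 0) \<Longrightarrow>
      Re ((A *\<^sub>v v) \<bullet>c v) \<le> c * vnorm2 v"
  shows "eig j A \<le> c"
proof -
  obtain U d where D: "unitary_diag n A U d" and mono: "\<forall>i j. i \<le> j \<longrightarrow> j < n \<longrightarrow> d j \<le> d i"
    and eig: "eig j A = d (j - 1)" using ex_unitary_diag[OF A] j by blast
  have k: "j - 1 < n" using j by auto
  obtain v where v: "v \<in> carrier_vec n" "v \<noteq> 0\<^sub>v n"
    and Uv: "\<forall>i<n. j - 1 < i \<longrightarrow> (mat_adjoint U *\<^sub>v v) $ i = 0" and Gv: "\<forall>i<j - 1. (G *\<^sub>v v) $ i = 0"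
    using ex_vec_common_kernel[OF unitary_matD(2)[OF unitary_diagD(1)[OF D]] G k] by blast
  have "eig j A * vnorm2 v \<le> Re ((A *\<^sub>v v) \<bullet>c v)"
    using Uv mono k unfolding eig by (intro unitary_diag_form_ge[OF D v(1)]) (meson not_less)
  also have "\<dots> \<le> c * vnorm2 v" using form v Gv by blast
  finally show ?thesis using vnorm2_pos[OF v] by simp
qed

text \<open>Lower half of min-max. The test space is cut out by the rows of \<open>G\<close> with
  index \<open>j\<close> to \<open>n - 1\<close>, so its dimension is at least \<open>j\<close> and
  it meets the span of the eigenvectors of \<open>A\<close> from the \<open>j\<close>-th on.\<close>

lemma eig_ge:
  assumes A: "hermitian_mat n A" and G: "G \<in> carrier_mat n n" and j: "j \<in> {1..n}"
    and form: "\<And>v. v \<in> carrier_vec n \<Longrightarrow> (\<And>i. i < n \<Longrightarrow> j \<le> i \<Longrightarrow> (G *\<^sub>v v) $ i = 0) \<Longrightarrow>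
      c * vnorm2 v \<le> Re ((A *\<^sub>v v) \<bullet>c v)"
  shows "c \<le> eig j A"
proof -
  obtain U d where D: "unitary_diag n A U d" and mono: "\<forall>i j. i \<le> j \<longrightarrow> j < n \<longrightarrow> d j \<le> d i"
    and eig: "eig j A = d (j - 1)" using ex_unitary_diag[OF A] j by blast
  have k: "j - 1 < n" using j by auto
  obtain v where v: "v \<in> carrier_vec n" "v \<noteq> 0\<^sub>v n"
    and Gv: "\<forall>i<n. j - 1 < i \<longrightarrow> (G *\<^sub>v v) $ i = 0" and Uv: "\<forall>i<j - 1. (mat_adjoint U *\<^sub>v v) $ i = 0"
    using ex_vec_common_kernel[OF G unitary_matD(2)[OF unitary_diagD(1)[OF D]] k] by blast
  have "c * vnorm2 v \<le> Re ((A *\<^sub>v v) \<bullet>c v)" using form v Gv j by fastforce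
  also have "\<dots> \<le> eig j A * vnorm2 v"
    using Uv mono k unfolding eig by (intro unitary_diag_form_le[OF D v(1)]) (meson not_less)
  finally show ?thesis using vnorm2_pos[OF v] by simp
qed

lemma eig_mono:
  assumes X: "hermitian_mat n X" and Y: "hermitian_mat n Y" and le: "loewner_le n X Y" and j: "j \<in> {1..n}"
  shows "eig j X \<le> eig j Y"
proof -
  obtain V e where D: "unitary_diag n Y V e" and mono: "\<forall>i j. i \<le> j \<longrightarrow> j < n \<longrightarrow> e j \<le> e i"
    and eig: "eig j Y = e (j - 1)" using ex_unitary_diag[OF Y] j by blast
  show ?thesis
  \<comment> \<open>The test space is spanned by the eigenvectors of \<open>Y\<close> from the
    \<open>j\<close>-th on, where the form of \<open>Y\<close> is at most \<open>eig j Y\<close>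
    times the squared norm.\<close>
  proof (rule eig_le[OF X unitary_matD(2)[OF unitary_diagD(1)[OF D]] j])
    fix v assume v: "v \<in> carrier_vec n"
      and Vv: "\<And>i. i < j - 1 \<Longrightarrow> (mat_adjoint V *\<^sub>v v) $ i = 0"
    note c = hermitian_matD(1)[OF X] hermitian_matD(1)[OF Y]
    have "((Y - X) *\<^sub>v v) \<bullet>c v = (Y *\<^sub>v v) \<bullet>c v - (X *\<^sub>v v) \<bullet>c v"
      using c v by (simp add: minus_mult_distrib_mat_vec[of _ n n] minus_scalar_prod_distrib[of _ n])
    then have "Re ((X *\<^sub>v v) \<bullet>c v) \<le> Re ((Y *\<^sub>v v) \<bullet>c v)"
      using le psd_matD(4)[of n "Y - X" v] v by (simp add: loewner_le_def)
    also have "\<dots> \<le> eig j Y * vnorm2 v"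
      using Vv mono unfolding eig by (intro unitary_diag_form_le[OF D v]) (meson not_less)
    finally show "Re ((X *\<^sub>v v) \<bullet>c v) \<le> eig j Y * vnorm2 v" .
  qed
qed

text \<open>Any decreasing diagonalisation shows the ordered eigenvalues: with
  \<open>G = U^*\<close> both halves of min-max give the value \<open>d (j - 1)\<close>.\<close>

lemma eig_unitary_diag:
  assumes D: "unitary_diag n A U d" and mono: "\<And>i j. i \<le> j \<Longrightarrow> j < n \<Longrightarrow> d j \<le> d i" and j: "j \<in> {1..n}"
  shows "eig j A = d (j - 1)"
proof (rule antisym)
  note G = unitary_matD(2)[OF unitary_diagD(1)[OF D]] and A = unitary_diag_hermitian[OF D]
  show "eig j A \<le> d (j - 1)"
    using mono by (intro eig_le[OF A G j] unitary_diag_form_le[OF D]) (auto simp: not_less[symmetric])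
  show "d (j - 1) \<le> eig j A"
  proof (intro eig_ge[OF A G j] unitary_diag_form_ge[OF D])
    fix v i assume "\<And>i. i < n \<Longrightarrow> j \<le> i \<Longrightarrow> (mat_adjoint U *\<^sub>v v) $ i = 0" "i < n"
    then show "(mat_adjoint U *\<^sub>v v) $ i = 0 \<or> d (j - 1) \<le> d i"
      using mono[of i "j - 1"] j by (cases "j \<le> i") auto
  qed
qed

text \<open>Squaring preserves the order of nonnegative eigenvalues. Applied to
  \<open>mat_abs X\<close>, this reduces its eigenvalues to those of \<open>X^* X\<close>, so no
  matrix square root has to be computed.\<close>

lemma eig_psd_square:
  assumes P: "psd_mat n P" and j: "j \<in> {1..n}"
  shows "eig j (P * P) = (eig j P)\<^sup>2" "0 \<le> eig j P"
proof -
  obtain U d where D: "unitary_diag n P U d" and mono: "\<forall>i j. i \<le> j \<longrightarrow> j < n \<longrightarrow> d j \<le> d i"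
    and eig: "eig j P = d (j - 1)" using ex_unitary_diag[OF psd_matD(1)[OF P]] j by blast
  have pos: "\<forall>i<n. 0 \<le> d i" using P psd_unitary_diag_iff[OF D] by blast
  have "eig j (P * P) = d (j - 1) * d (j - 1)"
    using mono pos j by (intro eig_unitary_diag[OF unitary_diag_mult[OF D D]]) (auto intro!: mult_mono)
  then show "eig j (P * P) = (eig j P)\<^sup>2" by (simp add: eig power2_eq_square)
  show "0 \<le> eig j P" using pos eig j by auto
qed

section \<open>Equivalence of the unitary and the eigenvalue form\<close>

lemma loewner_unitary_iff_eig:
  assumes H: "hermitian_mat n H" and Y: "hermitian_mat n Y"
  shows "(\<exists>U. unitary_mat n U \<and> loewner_le n (U * H * mat_adjoint U) Y) \<longleftrightarrow> (\<forall>j\<in>{1..n}. eig j H \<le> eig j Y)"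
proof
  assume "\<exists>U. unitary_mat n U \<and> loewner_le n (U * H * mat_adjoint U) Y"
  then obtain U where U: "unitary_mat n U" and le: "loewner_le n (U * H * mat_adjoint U) Y" by blast
  have "eig j (U * H * mat_adjoint U) = eig j H" for j
    using eigs_unitary_conj[OF U hermitian_matD(1)[OF H]] by (simp add: eig_def)
  then show "\<forall>j\<in>{1..n}. eig j H \<le> eig j Y"
    using eig_mono[OF hermitian_mat_conjugate[OF H unitary_matD(1)[OF U]] Y le] by simp
next
  assume le: "\<forall>j\<in>{1..n}. eig j H \<le> eig j Y"
  obtain U d where D: "unitary_diag n H U d" and d: "\<forall>j\<in>{1..n}. eig j H = d (j - 1)"
    using ex_unitary_diag[OF H] by blast
  obtain V e where E: "unitary_diag n Y V e" and e: "\<forall>j\<in>{1..n}. eig j Y = e (j - 1)"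
    using ex_unitary_diag[OF Y] by blast
  note U = unitary_matD[OF unitary_diagD(1)[OF D]] and V = unitary_matD[OF unitary_diagD(1)[OF E]]
  have de: "d i \<le> e i" if "i < n" for i
    using le[rule_format, of "Suc i"] d e that by simp
  let ?D = "\<lambda>d. mat_diag n (\<lambda>i. complex_of_real (d i))"
  \<comment> \<open>Carries the sorted eigenbasis of \<open>H\<close> to that of \<open>Y\<close>.
    Then \<open>V\<close> diagonalises both matrices, and the Loewner order becomes
    \<open>d i \<le> e i\<close> for each \<open>i\<close>.\<close>
  define W where "W = V * mat_adjoint U"
  have W: "unitary_mat n W"
    unfolding W_def using unitary_mat_mult unitary_mat_adjoint unitary_diagD(1) D E by blast
  have cancel: "mat_adjoint U * (U * X) = X" if "X \<in> carrier_mat n n" for X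
    using U that by (simp add: assoc_mult_mat[of _ n n _ n _ n, symmetric])
  have WH: "W * H * mat_adjoint W = V * ?D d * mat_adjoint V"
    unfolding W_def unitary_diagD(2)[OF D] using U(1,2) V(1,2) cancel
    by (simp add: mat_adjoint_mult[of V n n _ n] assoc_mult_mat[of _ n n _ n _ n])
  have "?D e - ?D d = ?D (\<lambda>i. e i - d i)"
    by (intro eq_matI) (auto simp: mat_diag_def)
  moreover have "Y - W * H * mat_adjoint W = V * (?D e - ?D d) * mat_adjoint V"
    unfolding WH unitary_diagD(2)[OF E] using V(1,2)
    by (simp add: mult_minus_distrib_mat[of _ n n _ n] minus_mult_distrib_mat[of _ n n _ _ n])
  ultimately have "unitary_diag n (Y - W * H * mat_adjoint W) V (\<lambda>i. e i - d i)"
    using unitary_diagD(1)[OF E] by (simp add: unitary_diag_def)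
  then have "loewner_le n (W * H * mat_adjoint W) Y"
    using psd_unitary_diag_iff de by (simp add: loewner_le_def)
  then show "\<exists>U. unitary_mat n U \<and> loewner_le n (U * H * mat_adjoint U) Y" using W by blast
qed

lemma hermitian_mat_add:
  assumes "hermitian_mat n A" "hermitian_mat n B"
  shows "hermitian_mat n (A + B)"
  using assms by (auto simp: hermitian_mat_def mat_adjoint_add[of _ n n])

lemma hermitian_mat_smult:
  assumes "hermitian_mat n A"
  shows "hermitian_mat n (complex_of_real c \<cdot>\<^sub>m A)"
  using assms by (auto simp: hermitian_mat_def mat_adjoint_smult)

lemma hermitian_weighted_powers3:
  assumes "psd_mat n A1" "psd_mat n A2" "psd_mat n A3"
  shows "hermitian_mat n (weighted_powers3 A1 A2 A3 p1 p2 p3)"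
  unfolding weighted_powers3_def mat_powr_def using assms
  by (intro hermitian_mat_add hermitian_mat_smult hermitian_mat_fun psd_matD(1))

lemma lin_unitary_iff_lin_eig:
  assumes "psd_mat n A1" "psd_mat n A2" "psd_mat n A3"
  shows "lin_unitary n A1 A2 A3 p1 p2 p3 \<longleftrightarrow> lin_eig n A1 A2 A3 p1 p2 p3"
proof -
  have "A1 * A2 * A3 \<in> carrier_mat n n" using assms psd_matD(2) by auto
  from psd_matD(1)[OF mat_abs(1)[OF this]] show ?thesis
    unfolding lin_unitary_def lin_eig_def
    by (intro loewner_unitary_iff_eig hermitian_weighted_powers3 assms)
qed

section \<open>Real powers of integer powers\<close>

lemma unitary_diag_pow:
  assumes "unitary_diag n A U d"
  shows "unitary_diag n (A ^\<^sub>m k) U (\<lambda>i. d i ^ k)"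
proof (induction k)
  case 0
  have "dim_row A = n" using unitary_diagD(4)[OF assms] by simp
  then show ?case
    using unitary_diagD(1)[OF assms] unitary_matD[of n U] by (simp add: unitary_diag_def)
next
  case (Suc k)
  then show ?case using unitary_diag_mult[OF Suc assms] by (simp add: mult.commute)
qed

text \<open>Reduces a real power to matrix multiplication whenever the base has a known root; used
  for \<open>k = 2\<close>, \<open>p = 3/2\<close>, \<open>m = 3\<close> and for
  \<open>k = 1\<close>, \<open>p = m = 6\<close>. At eigenvalue 0 both sides vanish, since
  \<open>m > 0\<close> forces \<open>k > 0\<close>.\<close>

lemma mat_powr_pow:
  assumes A: "psd_mat n A" and p: "real k * p = real m" "m > 0"
  shows "mat_powr (A ^\<^sub>m k) p = A ^\<^sub>m m"
proof -
  obtain U d where D: "unitary_diag n A U d" using ex_unitary_diag[OF psd_matD(1)[OF A]] by blast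
  have d: "\<forall>i<n. 0 \<le> d i" using A psd_unitary_diag_iff[OF D] by blast
  have k: "k > 0" using p by (cases k) auto
  have "(x ^ k) powr p = x ^ m" if "0 \<le> x" for x :: real
  proof (cases "x = 0")
    case False
    then have "(x ^ k) powr p = x powr (real k * p)"
      using that by (simp add: powr_realpow[symmetric] powr_powr)
    then show ?thesis using False that p by (simp add: powr_realpow)
  qed (use k p in \<open>simp add: zero_power\<close>)
  then have "mat_diag n (\<lambda>i. complex_of_real ((d i ^ k) powr p)) = mat_diag n (\<lambda>i. complex_of_real (d i ^ m))"
    using d by (intro eq_matI) (auto simp: mat_diag_def)
  then show ?thesis unfolding mat_powr_def
    using mat_fun_eq[OF unitary_diag_pow[OF D], of "\<lambda>x. x powr p" k] unitary_diagD(2)[OF unitary_diag_pow[OF D, of m]]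
    by simp
qed

subsection \<open>The counterexample\<close>

definition mat3 :: "real \<Rightarrow> real \<Rightarrow> real \<Rightarrow> real \<Rightarrow> real \<Rightarrow> real \<Rightarrow> real \<Rightarrow> real \<Rightarrow> real \<Rightarrow> complex mat" where
  "mat3 a b c d e f g h i = mat 3 3 (\<lambda>(k, l). complex_of_real ([[a, b, c], [d, e, f], [g, h, i]] ! k ! l))"

lemma mat3_carrier [simp]: "mat3 a b c d e f g h i \<in> carrier_mat 3 3"
  by (simp add: mat3_def)

lemma real_mat_mat3: "real_mat (mat3 a b c d e f g h i)"
  by (simp add: real_mat_def mat3_def)

lemma less_3_cases: "i < (3 :: nat) \<longleftrightarrow> i = 0 \<or> i = 1 \<or> i = 2"
  by auto

lemma all_less_3: "(\<forall>i<3. P i) \<longleftrightarrow> P (0 :: nat) \<and> P 1 \<and> P 2"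
  unfolding less_3_cases by auto

lemma sum_less_3: "(\<Sum>i = 0..<(3 :: nat). f i) = f 0 + f 1 + f 2"
  by (simp add: eval_nat_numeral)

lemma mat3_eqI:
  assumes "A \<in> carrier_mat 3 3" "B \<in> carrier_mat 3 3" "\<forall>i<3. \<forall>j<3. A $$ (i, j) = B $$ (i, j)"
  shows "A = B"
  using assms by (intro eq_matI) auto

lemma mat3_mult:
  "mat3 a b c d e f g h i * mat3 a' b' c' d' e' f' g' h' i' =
   mat3 (a * a' + b * d' + c * g') (a * b' + b * e' + c * h') (a * c' + b * f' + c * i')
        (d * a' + e * d' + f * g') (d * b' + e * e' + f * h') (d * c' + e * f' + f * i')
        (g * a' + h * d' + i * g') (g * b' + h * e' + i * h') (g * c' + h * f' + i * i')"
  by (intro mat3_eqI) (auto simp: all_less_3 mat3_def scalar_prod_def sum_less_3)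

lemma mat3_add:
  "mat3 a b c d e f g h i + mat3 a' b' c' d' e' f' g' h' i' =
   mat3 (a + a') (b + b') (c + c') (d + d') (e + e') (f + f') (g + g') (h + h') (i + i')"
  by (intro mat3_eqI) (auto simp: all_less_3 mat3_def)

lemma mat3_smult:
  "complex_of_real r \<cdot>\<^sub>m mat3 a b c d e f g h i =
   mat3 (r * a) (r * b) (r * c) (r * d) (r * e) (r * f) (r * g) (r * h) (r * i)"
  by (intro mat3_eqI) (auto simp: all_less_3 mat3_def)

lemma mat3_adjoint: "mat_adjoint (mat3 a b c d e f g h i) = mat3 a d g b e h c f i"
  by (intro mat3_eqI) (auto simp: all_less_3 mat3_def)

text \<open>For a real symmetric matrix the mixed terms of real and imaginary parts cancel, so
  estimates of the form need only be shown for real \<open>x\<close>, \<open>y\<close>,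
  \<open>z\<close>.\<close>

lemma mat3_form:
  fixes a b c e f i :: real
  assumes v: "v \<in> carrier_vec 3"
  defines "q \<equiv> \<lambda>x y z. a * x\<^sup>2 + e * y\<^sup>2 + i * z\<^sup>2 + 2 * b * x * y + 2 * c * x * z + 2 * f * y * z"
  shows "Re ((mat3 a b c b e f c f i *\<^sub>v v) \<bullet>c v)
    = q (Re (v $ 0)) (Re (v $ 1)) (Re (v $ 2)) + q (Im (v $ 0)) (Im (v $ 1)) (Im (v $ 2))"
  using v unfolding q_def
  by (simp add: mat3_def scalar_prod_def sum_less_3) (simp add: algebra_simps power2_eq_square)

lemma mat3_psd:
  assumes "\<And>x y z. 0 \<le> a * x\<^sup>2 + e * y\<^sup>2 + i * z\<^sup>2 + 2 * b * x * y + 2 * c * x * z + 2 * f * y * z"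
  shows "psd_mat 3 (mat3 a b c b e f c f i)"
  unfolding psd_mat_def hermitian_mat_def
  by (auto simp: mat3_adjoint mat3_form intro!: add_nonneg_nonneg[OF assms assms])

lemma vnorm2_3:
  assumes "v \<in> carrier_vec 3"
  shows "vnorm2 v = ((Re (v $ 0))\<^sup>2 + (Re (v $ 1))\<^sup>2 + (Re (v $ 2))\<^sup>2)
    + ((Im (v $ 0))\<^sup>2 + (Im (v $ 1))\<^sup>2 + (Im (v $ 2))\<^sup>2)"
  using assms by (simp add: vnorm2_def lessThan_atLeast0 sum_less_3 cmod_power2)

lemma mat3_vec_index:
  assumes "v \<in> carrier_vec 3"
  shows "(mat3 a b c d e f g h i *\<^sub>v v) $ 0 = a * v $ 0 + b * v $ 1 + c * v $ 2"
    "(mat3 a b c d e f g h i *\<^sub>v v) $ 2 = g * v $ 0 + h * v $ 1 + i * v $ 2"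
  using assms by (simp_all add: mat3_def scalar_prod_def sum_less_3)

text \<open>The square root of \<open>cex_A1\<close>, chosen rational so that the power 3/2 of
  \<open>cex_A1\<close> is simply the cube of this matrix.\<close>

definition cex_root_A1 :: "complex mat" where "cex_root_A1 = mat3 (1/2) 0 (1/2) 0 (1/2) 0 (1/2) 0 (1/2)"
definition cex_A1 :: "complex mat" where "cex_A1 = mat3 (1/2) 0 (1/2) 0 (1/4) 0 (1/2) 0 (1/2)"
text \<open>The lower block is \<open>w w^T\<close> with \<open>w = (1, 1/10)\<close>, of rank one
  and with squared norm 101/100, so its sixth power is \<open>(101/100)^5\<close> times the block
  itself.\<close>

definition cex_A2 :: "complex mat" where "cex_A2 = mat3 1 0 0 0 1 (1/10) 0 (1/10) (1/100)"
definition cex_A3 :: "complex mat" where "cex_A3 = mat3 1 0 0 0 1 0 0 0 100"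

section \<open>Positivity and powers of the three matrices\<close>

lemma psd_cex_root_A1: "psd_mat 3 cex_root_A1"
  unfolding cex_root_A1_def
proof (rule mat3_psd)
  fix x y z :: real
  have "0 \<le> 1/2 * (x + z)\<^sup>2 + 1/2 * y\<^sup>2" by simp
  then show "0 \<le> 1/2 * x\<^sup>2 + 1/2 * y\<^sup>2 + 1/2 * z\<^sup>2 + 2 * 0 * x * y + 2 * (1/2) * x * z + 2 * 0 * y * z"
    by (simp add: power2_eq_square algebra_simps)
qed

lemma psd_cex_A1: "psd_mat 3 cex_A1"
  unfolding cex_A1_def
proof (rule mat3_psd)
  fix x y z :: real
  have "0 \<le> 1/2 * (x + z)\<^sup>2 + 1/4 * y\<^sup>2" by simp
  then show "0 \<le> 1/2 * x\<^sup>2 + 1/4 * y\<^sup>2 + 1/2 * z\<^sup>2 + 2 * 0 * x * y + 2 * (1/2) * x * z + 2 * 0 * y * z"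
    by (simp add: power2_eq_square algebra_simps)
qed

lemma psd_cex_A2: "psd_mat 3 cex_A2"
  unfolding cex_A2_def
proof (rule mat3_psd)
  fix x y z :: real
  have "0 \<le> x\<^sup>2 + (y + 1/10 * z)\<^sup>2" by simp
  then show "0 \<le> 1 * x\<^sup>2 + 1 * y\<^sup>2 + 1/100 * z\<^sup>2 + 2 * 0 * x * y + 2 * 0 * x * z + 2 * (1/10) * y * z"
    by (simp add: power2_eq_square algebra_simps)
qed

lemma psd_cex_A3: "psd_mat 3 cex_A3"
  unfolding cex_A3_def by (rule mat3_psd) simp

lemmas mat3_pow_simps = eval_nat_numeral mat3_mult left_mult_one_mat[OF mat3_carrier]
  carrier_matD[OF mat3_carrier]

lemma powr_cex_A1: "mat_powr cex_A1 (3/2) = mat3 (1/2) 0 (1/2) 0 (1/8) 0 (1/2) 0 (1/2)"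
proof -
  have "cex_A1 = cex_root_A1 ^\<^sub>m 2"
    by (simp add: cex_A1_def cex_root_A1_def mat3_pow_simps)
  then have "mat_powr cex_A1 (3/2) = cex_root_A1 ^\<^sub>m 3"
    using mat_powr_pow[OF psd_cex_root_A1, of 2 "3/2" 3] by simp
  then show ?thesis
    by (simp add: cex_root_A1_def mat3_pow_simps)
qed

lemma mat_powr_six:
  assumes "psd_mat n A"
  shows "mat_powr A 6 = A ^\<^sub>m 6"
proof -
  have "A ^\<^sub>m 1 = A" using psd_matD(2)[OF assms] by simp
  then show ?thesis using mat_powr_pow[OF assms, of 1 6 6] by simp
qed

lemma powr_cex_A2: "mat_powr cex_A2 6 =
  mat3 1 0 0 0 ((101/100)^5) (1/10 * (101/100)^5) 0 (1/10 * (101/100)^5) (1/100 * (101/100)^5)"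
  unfolding mat_powr_six[OF psd_cex_A2] by (simp add: cex_A2_def mat3_pow_simps)

lemma powr_cex_A3: "mat_powr cex_A3 6 = mat3 1 0 0 0 1 0 0 0 (100^6)"
  unfolding mat_powr_six[OF psd_cex_A3] by (simp add: cex_A3_def mat3_pow_simps)

text \<open>The test vectors are those orthogonal to \<open>e\<^sub>3\<close>; on them the form does not see the huge
  \<open>(3, 3)\<close> entry and is diagonal.\<close>

lemma eig_cex_rhs_le:
  "eig 2 ((2/3) \<cdot>\<^sub>m mat_powr cex_A1 (3/2) + (1/6) \<cdot>\<^sub>m mat_powr cex_A2 6 + (1/6) \<cdot>\<^sub>m mat_powr cex_A3 6) \<le> 2/3"
proof -
  define t :: real where "t = (101/100)^5"
  \<comment> \<open>A crude bound suffices: it makes the middle diagonal entry of \<open>R\<close>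
    at most 7/12, below 2/3.\<close>
  have t: "t \<le> 2" by (simp add: t_def eval_nat_numeral)
  define r where "r = 2/3 * (1/2) + t/600 + 100^6/(6::real)"
  define R where "R = mat3 (2/3) 0 (1/3) 0 (1/12 + t/6 + 1/6) (t/60) (1/3) (t/60) r"
  \<comment> \<open>The coefficients are complex numerals, whereas \<open>mat3_smult\<close> expects
    embedded reals.\<close>
  have sm: "(2/3 :: complex) = complex_of_real (2/3)" "(1/6 :: complex) = complex_of_real (1/6)" by auto
  have "(2/3) \<cdot>\<^sub>m mat_powr cex_A1 (3/2) + (1/6) \<cdot>\<^sub>m mat_powr cex_A2 6 + (1/6) \<cdot>\<^sub>m mat_powr cex_A3 6 = R"
    unfolding powr_cex_A1 powr_cex_A2 powr_cex_A3 t_def[symmetric] sm mat3_smult mat3_add R_def r_def by simp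
  moreover have "eig 2 R \<le> 2/3"
  \<comment> \<open>For \<open>j = 2\<close> only row 0 of \<open>G\<close> imposes a condition, and
    it reads off \<open>v $ 2\<close>.\<close>
  proof (rule eig_le[of 3 _ "mat3 0 0 1 0 0 0 0 0 0"])
    show "hermitian_mat 3 R" by (simp add: R_def hermitian_mat_def mat3_adjoint)
  next
    fix v :: "complex vec" assume v: "v \<in> carrier_vec 3"
      and "\<And>i. i < 2 - 1 \<Longrightarrow> (mat3 0 0 1 0 0 0 0 0 0 *\<^sub>v v) $ i = 0"
    then have v2: "v $ 2 = 0" using mat3_vec_index(1)[OF v, of 0 0 1 0 0 0 0 0 0] by simp
    have le: "(1/12 + t/6 + 1/6) * y\<^sup>2 \<le> 2/3 * y\<^sup>2" for y :: real
      using t by (intro mult_right_mono) auto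
    show "Re ((R *\<^sub>v v) \<bullet>c v) \<le> 2/3 * vnorm2 v"
      unfolding R_def mat3_form[OF v] vnorm2_3[OF v] v2
      using le[of "Re (v $ 1)"] le[of "Im (v $ 1)"] by (simp add: algebra_simps)
  qed auto
  ultimately show ?thesis by simp
qed

text \<open>The kernel of the product is spanned by \<open>(0, 10, -1)\<close>; its orthogonal complement is tested.\<close>

lemma eig_cex_lhs_gt: "2/3 < eig 2 (mat_abs (cex_A1 * cex_A2 * cex_A3))"
proof -
  define X where "X = cex_A1 * cex_A2 * cex_A3"
  have X: "X = mat3 (1/2) (1/20) (1/2) 0 (1/4) (5/2) (1/2) (1/20) (1/2)"
    by (simp add: X_def cex_A1_def cex_A2_def cex_A3_def mat3_mult)
  have Xc: "X \<in> carrier_mat 3 3" by (simp add: X)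
  have XX: "mat_adjoint X * X = mat3 (1/2) (1/20) (1/2) (1/20) (27/400) (27/40) (1/2) (27/40) (27/4)"
    by (simp add: X mat3_adjoint mat3_mult)
  \<comment> \<open>The value 9/20 lies just above 4/9, the square of the bound 2/3 on the other
    side.\<close>
  have "9/20 \<le> eig 2 (mat_adjoint X * X)"
  \<comment> \<open>For \<open>j = 2\<close> only row 2 of \<open>G\<close> counts; it holds the
    kernel vector, so the test vectors are \<open>(x, y, 10 y)\<close>, with squared norm
    \<open>x^2 + 101 y^2\<close> in the real case.\<close>
  proof (rule eig_ge[of 3 _ "mat3 0 0 0 0 0 0 0 10 (-1)"])
    show "hermitian_mat 3 (mat_adjoint X * X)" by (rule psd_matD(1)[OF psd_adjoint_mult[OF Xc]])
  next
    fix v :: "complex vec" assume v: "v \<in> carrier_vec 3"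
      and G: "\<And>i. i < 3 \<Longrightarrow> 2 \<le> i \<Longrightarrow> (mat3 0 0 0 0 0 0 0 10 (- 1) *\<^sub>v v) $ i = 0"
    have v2: "v $ 2 = 10 * v $ 1"
      using mat3_vec_index(2)[OF v, of 0 0 0 0 0 0 0 10 "-1"] G[of 2] by simp
    have ge: "9/20 * (x\<^sup>2 + 101 * y\<^sup>2) \<le> 1/2 * x\<^sup>2 + 27/400 * y\<^sup>2 + 27/4 * (10 * y)\<^sup>2 + 2 * (1/20) * x * y
        + 2 * (1/2) * x * (10 * y) + 2 * (27/40) * y * (10 * y)" for x y :: real
    proof -
      \<comment> \<open>The difference of the two sides of \<open>ge\<close>, with the square
        completed in \<open>x\<close>.\<close>
      have "0 \<le> 1/20 * (x + 101 * y)\<^sup>2 + 1330675/10000 * y\<^sup>2" by simp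
      then show ?thesis by (simp add: power2_eq_square algebra_simps)
    qed
    show "9/20 * vnorm2 v \<le> Re ((mat_adjoint X * X *\<^sub>v v) \<bullet>c v)"
      unfolding XX mat3_form[OF v] vnorm2_3[OF v] v2
      using ge[of "Re (v $ 0)" "Re (v $ 1)"] ge[of "Im (v $ 0)" "Im (v $ 1)"]
      by (simp add: algebra_simps power2_eq_square)
  qed auto
  moreover have "eig 2 (mat_adjoint X * X) = (eig 2 (mat_abs X))\<^sup>2"
    using eig_psd_square(1)[OF mat_abs(1)[OF Xc], of 2] mat_abs(2)[OF Xc] by simp
  moreover have "(2/3 :: real)\<^sup>2 < 9/20" by (simp add: power2_eq_square)
  ultimately have "(2/3)\<^sup>2 < (eig 2 (mat_abs X))\<^sup>2" by linarith
  then have "2/3 < eig 2 (mat_abs X)"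
    by (rule power2_less_imp_less) (use eig_psd_square(2)[OF mat_abs(1)[OF Xc], of 2] in simp)
  then show ?thesis unfolding X_def .
qed

theorem theorem2:
  shows "(\<forall>n \<ge> 1. \<forall>A1 A2 A3 p1 p2 p3. lin_hyp n A1 A2 A3 p1 p2 p3 \<longrightarrow>
            (lin_unitary n A1 A2 A3 p1 p2 p3 \<longleftrightarrow> lin_eig n A1 A2 A3 p1 p2 p3))
       \<and> \<not> (\<forall>n \<ge> 1. \<forall>A1 A2 A3 p1 p2 p3. lin_hyp n A1 A2 A3 p1 p2 p3 \<longrightarrow>
              lin_unitary n A1 A2 A3 p1 p2 p3)
       \<and> 1 / (3 / 2) + 1 / 6 + 1 / 6 = (1 :: real)
       \<and> (\<exists>A1 A2 A3. real_mat A1 \<and> real_mat A2 \<and> real_mat A3 \<and>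
            psd_mat 3 A1 \<and> psd_mat 3 A2 \<and> psd_mat 3 A3 \<and>
            eig 2 (mat_abs (A1 * A2 * A3)) >
            eig 2 ((2 / 3) \<cdot>\<^sub>m mat_powr A1 (3 / 2) +
                   (1 / 6) \<cdot>\<^sub>m mat_powr A2 6 + (1 / 6) \<cdot>\<^sub>m mat_powr A3 6))"
proof (intro conjI)
  show iff: "\<forall>n \<ge> 1. \<forall>A1 A2 A3 p1 p2 p3. lin_hyp n A1 A2 A3 p1 p2 p3 \<longrightarrow>
            (lin_unitary n A1 A2 A3 p1 p2 p3 \<longleftrightarrow> lin_eig n A1 A2 A3 p1 p2 p3)"
    using lin_unitary_iff_lin_eig by (auto simp: lin_hyp_def)
  have less: "eig 2 ((2 / 3) \<cdot>\<^sub>m mat_powr cex_A1 (3 / 2) + (1 / 6) \<cdot>\<^sub>m mat_powr cex_A2 6 + (1 / 6) \<cdot>\<^sub>m mat_powr cex_A3 6)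
      < eig 2 (mat_abs (cex_A1 * cex_A2 * cex_A3))"
    using eig_cex_rhs_le eig_cex_lhs_gt by (rule le_less_trans)
  have "lin_hyp 3 cex_A1 cex_A2 cex_A3 (3/2) 6 6"
    using psd_cex_A1 psd_cex_A2 psd_cex_A3 by (simp add: lin_hyp_def)
  moreover have "\<not> lin_eig 3 cex_A1 cex_A2 cex_A3 (3/2) 6 6"
    \<comment> \<open>The eigenvalue form fails at index 2, where \<open>1 / (3/2)\<close>
      simplifies to the coefficient 2/3 of \<open>less\<close>.\<close>
    using less by (auto simp: lin_eig_def weighted_powers3_def intro!: bexI[of _ 2])
  ultimately show "\<not> (\<forall>n \<ge> 1. \<forall>A1 A2 A3 p1 p2 p3. lin_hyp n A1 A2 A3 p1 p2 p3 \<longrightarrow>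
              lin_unitary n A1 A2 A3 p1 p2 p3)"
    \<comment> \<open>The equivalence, at \<open>n = 3\<close>, turns the failure of the eigenvalue
      form into that of the unitary form.\<close>
    using iff by (metis one_le_numeral)
  show "\<exists>A1 A2 A3. real_mat A1 \<and> real_mat A2 \<and> real_mat A3 \<and>
            psd_mat 3 A1 \<and> psd_mat 3 A2 \<and> psd_mat 3 A3 \<and>
            eig 2 (mat_abs (A1 * A2 * A3)) >
            eig 2 ((2 / 3) \<cdot>\<^sub>m mat_powr A1 (3 / 2) +
                   (1 / 6) \<cdot>\<^sub>m mat_powr A2 6 + (1 / 6) \<cdot>\<^sub>m mat_powr A3 6)"
    using less psd_cex_A1 psd_cex_A2 psd_cex_A3 real_mat_mat3 unfolding cex_A1_def cex_A2_def cex_A3_def by blast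
qed simp

end
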